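(* Let $1<\alpha<\beta$ be real numbers and let $r\ge2$ be an integer. Then $$c_r(\alpha)\le c_r(\beta).$$ Moreover, $$c_r(\alpha)=c_r(\beta)\iff \lfloor i\alpha\rfloor=\lfloor i\beta\rfloor\quad(1\le i<r).$$ Hence, for fixed $r$, the function $\alpha\mapsto c_r(\alpha)$ on $(1,\infty)$ is a nondecreasing step function whose constant cells (maximal sets on which it is constant) are exactly the cells of the finite Beatty prefix, i.e. the sets of $\alpha>1$ on which the vector $\bigl(\lfloor\alpha\rfloor,\lfloor2\alpha\rfloor,\dots,\lfloor(r-1)\alpha\rfloor\bigr)$ takes a given value.
   Context: For real $\alpha>1$ and an integer $r\ge2$, $c_r(\alpha)$ denotes the number of integer sequences $1\le s_1<s_2<\cdots<s_{r-1}$ satisfying $s_i\le\lfloor i\alpha\rfloor$ for all $1\le i<r$. *)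

theory Defs
  imports "HOL-Analysis.Analysis"
begin

text \<open>Sequences with index set \<open>{1..<r}\<close> are functions that are \<^const>\<open>undefined\<close> outside it,
  so that distinct functions are distinct sequences.\<close>

definition beatty_seqs :: "nat \<Rightarrow> real \<Rightarrow> (nat \<Rightarrow> int) set" where
  "beatty_seqs r \<alpha> = {s \<in> extensional {1..<r}.
     1 \<le> s 1 \<and> strict_mono_on {1..<r} s \<and> (\<forall>i\<in>{1..<r}. s i \<le> \<lfloor>real i * \<alpha>\<rfloor>)}"

definition beatty_count :: "nat \<Rightarrow> real \<Rightarrow> nat" where
  "beatty_count r \<alpha> = card (beatty_seqs r \<alpha>)"

lemma finite_beatty_seqs:
  assumes "r \<ge> 2"
  shows "finite (beatty_seqs r \<alpha>)"
proof (rule finite_subset)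
  show "beatty_seqs r \<alpha> \<subseteq> (\<Pi>\<^sub>E i\<in>{1..<r}. {1..\<lfloor>real i * \<alpha>\<rfloor>})"
  proof
    fix s assume s: "s \<in> beatty_seqs r \<alpha>"
    have "1 \<le> s i" if i: "i \<in> {1..<r}" for i
    proof (cases "i = 1")
      case True
      then show ?thesis using s by (simp add: beatty_seqs_def)
    next
      case False
      then have "s 1 < s i"
        using s i assms by (auto simp: beatty_seqs_def intro: strict_mono_onD)
      then show ?thesis using s by (simp add: beatty_seqs_def)
    qed
    then show "s \<in> (\<Pi>\<^sub>E i\<in>{1..<r}. {1..\<lfloor>real i * \<alpha>\<rfloor>})"
      using s by (auto simp: beatty_seqs_def PiE_def)
  qed
qed (simp add: finite_PiE)

definition beatty_prefix :: "nat \<Rightarrow> real \<Rightarrow> int list" where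
  "beatty_prefix r \<alpha> = map (\<lambda>i. \<lfloor>real i * \<alpha>\<rfloor>) [1..<r]"

text \<open>Only attained values of the prefix are used, so the empty set is not a cell.\<close>

definition beatty_cells :: "nat \<Rightarrow> real set set" where
  "beatty_cells r = {{\<alpha> \<in> {1<..}. beatty_prefix r \<alpha> = v} | v. v \<in> beatty_prefix r ` {1<..}}"

definition constant_cells :: "('a \<Rightarrow> 'b) \<Rightarrow> 'a set \<Rightarrow> 'a set set" where
  "constant_cells f S = {C. C \<subseteq> S \<and> f constant_on C \<and>
     (\<forall>D. C \<subseteq> D \<and> D \<subseteq> S \<and> f constant_on D \<longrightarrow> D = C)}"

text \<open>On an unbounded domain a step function may have infinitely many pieces, but only finitely
  many of them meet any bounded interval. Pieces may be singletons.\<close>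

definition step_function_on :: "real set \<Rightarrow> (real \<Rightarrow> 'b) \<Rightarrow> bool" where
  "step_function_on S f \<longleftrightarrow> (\<forall>a b. \<exists>P. finite P \<and> partition_on (S \<inter> {a..b}) P \<and>
     (\<forall>I\<in>P. is_interval I \<and> f constant_on I))"

end

theory Submission
  imports Defs
begin

text \<open>Since \<open>\<alpha> > 1\<close>, the sequence \<open>\<lfloor>i\<alpha>\<rfloor>\<close> is itself strictly increasing, hence admissible, and it
  is the pointwise largest admissible sequence. So the set of admissible sequences grows with \<open>\<alpha>\<close>
  and determines the Beatty prefix; as the sets are nested and finite, so does their cardinality.\<close>

lemma beatty_seqs_mono:
  assumes "\<alpha> \<le> \<beta>"
  shows "beatty_seqs r \<alpha> \<subseteq> beatty_seqs r \<beta>"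
proof -
  have "\<lfloor>real i * \<alpha>\<rfloor> \<le> \<lfloor>real i * \<beta>\<rfloor>" for i
    using assms by (intro floor_mono mult_left_mono) auto
  then show ?thesis
    unfolding beatty_seqs_def by (blast intro: order_trans)
qed

text \<open>One step of the index adds \<open>\<alpha>\<close>, which exceeds 1, so the floor rises
  by at least 1.\<close>

lemma floor_mult_less:
  assumes "1 < \<alpha>" "i < j"
  shows "\<lfloor>real i * \<alpha>\<rfloor> < \<lfloor>real j * \<alpha>\<rfloor>"
proof -
  have "real i * \<alpha> + 1 \<le> real i * \<alpha> + \<alpha>"
    using assms by simp
  also have "\<dots> = real (Suc i) * \<alpha>"
    by (simp add: algebra_simps)
  also have "\<dots> \<le> real j * \<alpha>"
    using assms by (intro mult_right_mono) auto
  finally show ?thesis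
    by linarith
qed

lemma floor_mult_in_beatty_seqs:
  assumes "2 \<le> r" "1 < \<alpha>"
  shows "restrict (\<lambda>i. \<lfloor>real i * \<alpha>\<rfloor>) {1..<r} \<in> beatty_seqs r \<alpha>"
  \<comment> \<open>The bound \<open>2 \<le> r\<close> places the index 1 in the range, so the first
    entry is the floor of \<open>\<alpha>\<close>, at least 1, and not
    \<open>undefined\<close>.\<close>
  using assms by (auto simp: beatty_seqs_def strict_mono_on_def le_floor_iff floor_mult_less)

text \<open>The extremal sequence for \<open>\<beta>\<close> serves as a witness: lying in the set
  for \<open>\<alpha>\<close>, it must obey the bounds of \<open>\<alpha>\<close>. This recovers the
  prefix from the set of sequences.\<close>

lemma floor_mult_le_if_beatty_seqs_subset:
  assumes "2 \<le> r" "1 < \<beta>" "beatty_seqs r \<beta> \<subseteq> beatty_seqs r \<alpha>" "i \<in> {1..<r}"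
  shows "\<lfloor>real i * \<beta>\<rfloor> \<le> \<lfloor>real i * \<alpha>\<rfloor>"
proof -
  have "restrict (\<lambda>i. \<lfloor>real i * \<beta>\<rfloor>) {1..<r} \<in> beatty_seqs r \<alpha>"
    using floor_mult_in_beatty_seqs assms by blast
  then show ?thesis
    using assms(4) by (fastforce simp: beatty_seqs_def)
qed

lemma beatty_count_mono:
  assumes "2 \<le> r" "\<alpha> \<le> \<beta>"
  shows "beatty_count r \<alpha> \<le> beatty_count r \<beta>"
  unfolding beatty_count_def
  by (intro card_mono finite_beatty_seqs beatty_seqs_mono assms)

lemma beatty_prefix_eq_iff:
  "beatty_prefix r \<alpha> = beatty_prefix r \<beta> \<longleftrightarrow> (\<forall>i\<in>{1..<r}. \<lfloor>real i * \<alpha>\<rfloor> = \<lfloor>real i * \<beta>\<rfloor>)"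
  by (simp add: beatty_prefix_def)

text \<open>Covers both orders of \<open>\<alpha>\<close> and \<open>\<beta>\<close>, so that count
  and prefix are seen to induce the same equivalence relation on the reals above 1; the description
  of the cells rests on this.\<close>

lemma beatty_count_eq_iff_beatty_prefix_eq:
  assumes r: "2 \<le> r" and "1 < \<alpha>" "1 < \<beta>"
  shows "beatty_count r \<alpha> = beatty_count r \<beta> \<longleftrightarrow> beatty_prefix r \<alpha> = beatty_prefix r \<beta>"
  using assms(2,3)
proof (induction \<alpha> \<beta> rule: linorder_wlog)
  case (le \<alpha> \<beta>)
  show ?case
  proof
    assume "beatty_count r \<alpha> = beatty_count r \<beta>"
    then have "beatty_seqs r \<alpha> = beatty_seqs r \<beta>"
      unfolding beatty_count_def
      using card_subset_eq[OF finite_beatty_seqs[OF r] beatty_seqs_mono[OF le(1)]] by simp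
    then show "beatty_prefix r \<alpha> = beatty_prefix r \<beta>"
      unfolding beatty_prefix_eq_iff
      by (intro ballI antisym floor_mult_le_if_beatty_seqs_subset[OF r]) (use le in auto)
  next
    \<comment> \<open>The parameter enters \<open>beatty_seqs\<close> only through the upper bounds,
      which are the entries of the prefix.\<close>
    assume "beatty_prefix r \<alpha> = beatty_prefix r \<beta>"
    then have "beatty_seqs r \<alpha> = beatty_seqs r \<beta>"
      unfolding beatty_prefix_eq_iff beatty_seqs_def by auto
    then show "beatty_count r \<alpha> = beatty_count r \<beta>"
      by (simp add: beatty_count_def)
  qed
next
  case (sym \<alpha> \<beta>)
  then show ?case by metis
qed

text \<open>Each entry of the prefix is monotone in the parameter, so between two points with equal
  prefixes it is squeezed to the same value.\<close>

lemma is_interval_beatty_prefix_fibre: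
  assumes "is_interval S"
  shows "is_interval {\<alpha> \<in> S. beatty_prefix r \<alpha> = v}"
  unfolding is_interval_1
proof (intro ballI allI impI)
  fix a b x
  assume a: "a \<in> {\<alpha> \<in> S. beatty_prefix r \<alpha> = v}" and b: "b \<in> {\<alpha> \<in> S. beatty_prefix r \<alpha> = v}"
    and x: "a \<le> x \<and> x \<le> b"
  have "x \<in> S"
    using assms a b x unfolding is_interval_1 by blast
  have "\<lfloor>real i * x\<rfloor> = \<lfloor>real i * a\<rfloor>" if "i \<in> {1..<r}" for i
  proof (rule antisym)
    have "\<lfloor>real i * x\<rfloor> \<le> \<lfloor>real i * b\<rfloor>"
      using x by (intro floor_mono mult_left_mono) auto
    also have "\<dots> = \<lfloor>real i * a\<rfloor>"
      using a b that beatty_prefix_eq_iff[of r b a] by simp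
    finally show "\<lfloor>real i * x\<rfloor> \<le> \<lfloor>real i * a\<rfloor>" .
    show "\<lfloor>real i * a\<rfloor> \<le> \<lfloor>real i * x\<rfloor>"
      using x by (intro floor_mono mult_left_mono) auto
  qed
  then have "beatty_prefix r x = beatty_prefix r a"
    by (simp add: beatty_prefix_eq_iff)
  then show "x \<in> {\<alpha> \<in> S. beatty_prefix r \<alpha> = v}"
    using a \<open>x \<in> S\<close> by simp
qed

text \<open>By monotonicity each entry stays between its values at \<open>a\<close> and
  \<open>b\<close>. Pooling these finite integer ranges into one alphabet leaves lists of fixed
  length over a finite set.\<close>

lemma finite_beatty_prefix_image:
  assumes "S \<subseteq> {a..b}"
  shows "finite (beatty_prefix r ` S)"
proof (rule finite_subset)
  let ?A = "\<Union>i\<in>{1..<r}. {\<lfloor>real i * a\<rfloor>..\<lfloor>real i * b\<rfloor>}"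
  show "beatty_prefix r ` S \<subseteq> {xs. set xs \<subseteq> ?A \<and> length xs = r - 1}"
  proof (rule image_subsetI)
    fix x assume "x \<in> S"
    then have x: "a \<le> x" "x \<le> b"
      using assms by auto
    have "\<lfloor>real i * x\<rfloor> \<in> {\<lfloor>real i * a\<rfloor>..\<lfloor>real i * b\<rfloor>}" for i
      using x by (auto intro!: floor_mono mult_left_mono)
    then have "set (beatty_prefix r x) \<subseteq> ?A"
      unfolding beatty_prefix_def set_map set_upt by blast
    then show "beatty_prefix r x \<in> {xs. set xs \<subseteq> ?A \<and> length xs = r - 1}"
      by (simp add: beatty_prefix_def)
  qed
qed (rule finite_lists_length_eq, simp)

text \<open>Only attained values index the fibres, which keeps the empty set out of the
  partition.\<close>

lemma partition_on_fibres:
  "partition_on S ((\<lambda>v. {x \<in> S. g x = v}) ` g ` S)"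
  by (auto simp: partition_on_def disjoint_def)

text \<open>Both sides are the classes of the one equivalence relation that \<open>f\<close> and
  \<open>g\<close> induce on \<open>S\<close>. For empty \<open>S\<close> the equation would fail:
  the empty set would be a constant cell, but there would be no fibre.\<close>

lemma constant_cells_eq_fibres:
  assumes "S \<noteq> {}" and fg: "\<And>x y. x \<in> S \<Longrightarrow> y \<in> S \<Longrightarrow> f x = f y \<longleftrightarrow> g x = g y"
  shows "constant_cells f S = {{x \<in> S. g x = v} | v. v \<in> g ` S}"
proof (intro equalityI subsetI)
  fix C assume "C \<in> constant_cells f S"
  then have C: "C \<subseteq> S" "f constant_on C"
    and max: "\<And>D. C \<subseteq> D \<Longrightarrow> D \<subseteq> S \<Longrightarrow> f constant_on D \<Longrightarrow> D = C"
    by (auto simp: constant_cells_def)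
  \<comment> \<open>Every function is constant on the empty set, but any singleton in
    \<open>S\<close> properly enlarges it.\<close>
  have "C \<noteq> {}"
  proof
    assume "C = {}"
    obtain x where "x \<in> S" using assms(1) by blast
    then show False
      using max[of "{x}"] \<open>C = {}\<close> by (simp add: constant_on_def)
  qed
  then obtain c where c: "c \<in> C" by blast
  then have "c \<in> S" using C by blast
  \<comment> \<open>The fibre through \<open>c\<close> contains \<open>C\<close> and
    \<open>f\<close> is constant on it, so maximality of \<open>C\<close> forces equality.\<close>
  have "{x \<in> S. g x = g c} = C"
  proof (rule max)
    have "f x = f c" if "x \<in> C" for x
      using C(2) c that by (auto simp: constant_on_def)
    then show "C \<subseteq> {x \<in> S. g x = g c}"
      using C(1) \<open>c \<in> S\<close> fg by auto
    show "f constant_on {x \<in> S. g x = g c}"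
      using \<open>c \<in> S\<close> fg unfolding constant_on_def by auto
  qed blast
  then show "C \<in> {{x \<in> S. g x = v} | v. v \<in> g ` S}"
    using \<open>c \<in> S\<close> by auto
next
  fix C assume "C \<in> {{x \<in> S. g x = v} | v. v \<in> g ` S}"
  then obtain c where c: "c \<in> S" and C: "C = {x \<in> S. g x = g c}"
    by blast
  have "f constant_on C"
    using c C fg unfolding constant_on_def by auto
  moreover have "D = C" if "C \<subseteq> D" "D \<subseteq> S" "f constant_on D" for D
  proof -
    have "c \<in> D" using c C that by blast
    then have "f x = f c" if "x \<in> D" for x
      using that \<open>f constant_on D\<close> by (auto simp: constant_on_def)
    then have "D \<subseteq> C" using \<open>D \<subseteq> S\<close> c fg unfolding C by auto
    with that show ?thesis by blast
  qed
  moreover have "C \<subseteq> S"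
    using C by blast
  ultimately show "C \<in> constant_cells f S"
    unfolding constant_cells_def by blast
qed

text \<open>The pieces are the prefix fibres cut down to the window from \<open>a\<close> to
  \<open>b\<close>: intervals because the window is one, and finitely many because the window is
  bounded.\<close>

lemma step_function_on_beatty_count:
  assumes "2 \<le> r"
  shows "step_function_on {1<..} (beatty_count r)"
  unfolding step_function_on_def
proof (intro allI)
  fix a b :: real
  let ?S = "{1<..} \<inter> {a..b}"
  let ?P = "(\<lambda>v. {x \<in> ?S. beatty_prefix r x = v}) ` beatty_prefix r ` ?S"
  have "is_interval ?S"
    by (intro is_interval_Int is_interval_oi is_interval_cc)
  then have "is_interval I" if "I \<in> ?P" for I
    using that is_interval_beatty_prefix_fibre by blast
  moreover have "beatty_count r constant_on I" if "I \<in> ?P" for I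
  proof -
    obtain c where c: "1 < c" and I: "I = {x \<in> ?S. beatty_prefix r x = beatty_prefix r c}"
      using \<open>I \<in> ?P\<close> by auto
    have "beatty_count r x = beatty_count r c" if "x \<in> I" for x
      using that c beatty_count_eq_iff_beatty_prefix_eq[OF assms, of x c] unfolding I by simp
    then show ?thesis
      unfolding constant_on_def by blast
  qed
  moreover have "finite ?P"
    by (intro finite_imageI finite_beatty_prefix_image) auto
  ultimately show "\<exists>P. finite P \<and> partition_on ?S P \<and>
      (\<forall>I\<in>P. is_interval I \<and> beatty_count r constant_on I)"
    using partition_on_fibres[of ?S "beatty_prefix r"] by (intro exI[of _ ?P]) simp
qed

theorem proposition9:
  fixes r :: nat
  assumes "r \<ge> 2"
  shows "(\<forall>\<alpha> \<beta> :: real. 1 < \<alpha> \<and> \<alpha> < \<beta> \<longrightarrow>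
            beatty_count r \<alpha> \<le> beatty_count r \<beta> \<and>
            (beatty_count r \<alpha> = beatty_count r \<beta> \<longleftrightarrow>
              (\<forall>i\<in>{1..<r}. \<lfloor>real i * \<alpha>\<rfloor> = \<lfloor>real i * \<beta>\<rfloor>))) \<and>
         mono_on {1<..} (beatty_count r) \<and>
         step_function_on {1<..} (beatty_count r) \<and>
         constant_cells (beatty_count r) {1<..} = beatty_cells r"
proof (intro conjI)
  show "\<forall>\<alpha> \<beta> :: real. 1 < \<alpha> \<and> \<alpha> < \<beta> \<longrightarrow>
            beatty_count r \<alpha> \<le> beatty_count r \<beta> \<and>
            (beatty_count r \<alpha> = beatty_count r \<beta> \<longleftrightarrow>
              (\<forall>i\<in>{1..<r}. \<lfloor>real i * \<alpha>\<rfloor> = \<lfloor>real i * \<beta>\<rfloor>))"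
    using beatty_count_mono[OF assms] beatty_count_eq_iff_beatty_prefix_eq[OF assms]
    by (simp add: beatty_prefix_eq_iff)
  show "mono_on {1<..} (beatty_count r)"
    by (intro mono_onI beatty_count_mono assms)
  show "step_function_on {1<..} (beatty_count r)"
    by (rule step_function_on_beatty_count[OF assms])
  show "constant_cells (beatty_count r) {1<..} = beatty_cells r"
    unfolding beatty_cells_def
    by (intro constant_cells_eq_fibres beatty_count_eq_iff_beatty_prefix_eq assms) auto
qed

end
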